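(* Consider $\min_{x\in X}F(x)$, $F=f_1+f_2$, where $x=(x_1,\dots,x_K)$ with $x_k\in\mathbb{R}^{i_k}$, $\sum_{k=1}^K i_k=n$. Assume that $f_1(x)=d_1(x_1)+\cdots+d_K(x_K)$ with each $d_k$ convex, that $X=X_1\times\cdots\times X_K$ with each $X_k\subseteq\mathbb{R}^{i_k}$ closed and convex, and that $f_2$ is strongly convex in each block: there is $\gamma>0$ such that for every $x\in X$, every $s\in\{1,\dots,K\}$ and every $\Delta x_s\in\mathbb{R}^{i_s}$ with $x_s+\Delta x_s\in X_s$, $$f_2(x_1,\dots,x_{s-1},x_s+\Delta x_s,x_{s+1},\dots,x_K)-f_2(x)-\langle\nabla_s f_2(x),\Delta x_s\rangle\ge\gamma\|\Delta x_s\|^2 .$$ Then the block coordinate descent method with cyclic update, with one full cycle of $K$ block updates counted as one iteration, is an approximate proximal splitting (APS) method with some constant $\kappa>0$. That is, there is a constant $\kappa>0$ such that for every sequence $\{x^r\}_{r\ge0}$ generated by the cyclic block coordinate descent method, the sequence $y^s:=x^{sK}$, $s=0,1,\dots$, satisfies $$y^{s+1}=\mathrm{prox}_{\alpha^s f_1}\big(y^s-\alpha^s(\nabla f_2(y^s)+e^s)\big),\qquad \|e^s\|\le\kappa\|y^s-y^{s+1}\|,\qquad s=0,1,\dots,$$ for some positive scalars $\alpha^s$ with $\liminf_s\alpha^s>0$ and some vectors $e^s\in\mathbb{R}^n$.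
   Context: Setting: $X\subseteq\mathbb{R}^n$ is nonempty, closed and convex; $f_1$ is convex and possibly non-smooth (the $d_k:\mathbb{R}^{i_k}\to(-\infty,+\infty]$ are proper, closed, convex, and finite at some point of $X_k$); $f_2:\mathbb{R}^n\to\mathbb{R}$ is convex and differentiable with Lipschitz continuous gradient. $\|\cdot\|$ is the Euclidean norm, and $\nabla_s f_2$ is the vector of partial derivatives of $f_2$ with respect to the $s$-th block. Proximity operator: $\mathrm{prox}_{\varphi}(x)=\arg\min_{y\in X}\{\varphi(y)+\frac12\|y-x\|^2\}$ (minimization over the constraint set $X$). Block coordinate descent (BCD) method: starting from $x^0\in X$ with $F(x^0)<\infty$, at each iteration $r\ge0$ a block index $s\in\{1,\dots,K\}$ is chosen and $x_s^{r+1}=\arg\min_{x_s\in X_s}F(x_1^r,\dots,x_{s-1}^r,x_s,x_{s+1}^r,\dots,x_K^r)$, $\;x_j^{r+1}=x_j^r$ for $j\ne s$. Cyclic update means the blocks are updated in the order $1,2,\dots,K,1,2,\dots,K,\dots$, i.e. for every $s\ge0$ and $1\le k\le K$, $x^{sK+k}$ is obtained from $x^{sK+k-1}$ by updating block $k$. *)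

theory Defs
  imports "HOL-Analysis.Analysis"
begin

text \<open>
  Block structure on \<open>real ^ 'n\<close>: a labelling \<open>b :: 'n \<Rightarrow> nat\<close> assigns to each coordinate the
  number (in \<open>{1..K}\<close>) of the block it belongs to. The space of the \<open>k\<close>-th block variable, of
  dimension \<open>card {i. b i = k}\<close>, is represented by the coordinate subspace
  \<open>block_space b k\<close>, on which norm, inner product and topology are those inherited from
  \<open>real ^ 'n\<close>. Functions and sets attached to block \<open>k\<close> are only ever looked at on this subspace.
\<close>

definition block_space :: "('n \<Rightarrow> nat) \<Rightarrow> nat \<Rightarrow> (real ^ 'n) set" where
  "block_space b k = {z. \<forall>i. b i \<noteq> k \<longrightarrow> z $ i = 0}"

definition block :: "('n \<Rightarrow> nat) \<Rightarrow> nat \<Rightarrow> real ^ 'n \<Rightarrow> real ^ 'n" where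
  "block b k x = (\<chi> i. if b i = k then x $ i else 0)"

definition block_upd :: "('n \<Rightarrow> nat) \<Rightarrow> nat \<Rightarrow> real ^ 'n \<Rightarrow> real ^ 'n \<Rightarrow> real ^ 'n" where
  "block_upd b k x z = (\<chi> i. if b i = k then z $ i else x $ i)"

definition block_product :: "('n \<Rightarrow> nat) \<Rightarrow> nat \<Rightarrow> (nat \<Rightarrow> (real ^ 'n) set) \<Rightarrow> (real ^ 'n) set" where
  "block_product b K Xs = {x. \<forall>k\<in>{1..K}. block b k x \<in> Xs k}"

definition separable_sum ::
  "('n \<Rightarrow> nat) \<Rightarrow> nat \<Rightarrow> (nat \<Rightarrow> real ^ 'n \<Rightarrow> ereal) \<Rightarrow> real ^ 'n \<Rightarrow> ereal" where
  "separable_sum b K d x = (\<Sum>k=1..K. d k (block b k x))"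

definition proper_fun_on :: "'a set \<Rightarrow> ('a \<Rightarrow> ereal) \<Rightarrow> bool" where
  "proper_fun_on S \<phi> \<longleftrightarrow> (\<forall>x\<in>S. \<phi> x \<noteq> -\<infinity>) \<and> (\<exists>x\<in>S. \<phi> x \<noteq> \<infinity>)"

text \<open>Endpoints \<open>u = 0, 1\<close> are harmless below since \<open>0 * \<infinity> = 0\<close> for extended reals.\<close>

definition ereal_convex_on :: "'a::real_vector set \<Rightarrow> ('a \<Rightarrow> ereal) \<Rightarrow> bool" where
  "ereal_convex_on S \<phi> \<longleftrightarrow> convex S \<and>
     (\<forall>x\<in>S. \<forall>y\<in>S. \<forall>u\<in>{0..1::real}.
        \<phi> (u *\<^sub>R x + (1 - u) *\<^sub>R y) \<le> ereal u * \<phi> x + ereal (1 - u) * \<phi> y)"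

definition closed_fun_on :: "'a::topological_space set \<Rightarrow> ('a \<Rightarrow> ereal) \<Rightarrow> bool" where
  "closed_fun_on S \<phi> \<longleftrightarrow> closed {(x, t::real). x \<in> S \<and> \<phi> x \<le> ereal t}"

definition prox :: "'a::real_normed_vector set \<Rightarrow> ('a \<Rightarrow> ereal) \<Rightarrow> 'a \<Rightarrow> 'a" where
  "prox X \<phi> x =
     (THE y. is_arg_min (\<lambda>y. \<phi> y + ereal (1/2 * (norm (y - x))\<^sup>2)) (\<lambda>y. y \<in> X) y)"

definition block_strongly_convex ::
  "('n::finite \<Rightarrow> nat) \<Rightarrow> nat \<Rightarrow> (nat \<Rightarrow> (real ^ 'n) set) \<Rightarrow>
    (real ^ 'n \<Rightarrow> real) \<Rightarrow> (real ^ 'n \<Rightarrow> real ^ 'n) \<Rightarrow> real \<Rightarrow> bool" where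
  "block_strongly_convex b K Xs f g \<gamma> \<longleftrightarrow>
     (\<forall>x\<in>block_product b K Xs. \<forall>s\<in>{1..K}. \<forall>\<Delta>\<in>block_space b s.
        block b s x + \<Delta> \<in> Xs s \<longrightarrow>
        f (block_upd b s x (block b s x + \<Delta>)) - f x - block b s (g x) \<bullet> \<Delta> \<ge> \<gamma> * (norm \<Delta>)\<^sup>2)"

definition bcd_step ::
  "('n \<Rightarrow> nat) \<Rightarrow> nat \<Rightarrow> (nat \<Rightarrow> (real ^ 'n) set) \<Rightarrow> (real ^ 'n \<Rightarrow> ereal) \<Rightarrow>
    nat \<Rightarrow> real ^ 'n \<Rightarrow> real ^ 'n \<Rightarrow> bool" where
  "bcd_step b K Xs F s x x' \<longleftrightarrow>
     is_arg_min (\<lambda>z. F (block_upd b s x z)) (\<lambda>z. z \<in> Xs s) (block b s x') \<and>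
     (\<forall>j\<in>{1..K}. j \<noteq> s \<longrightarrow> block b j x' = block b j x)"

definition cyclic_bcd ::
  "('n \<Rightarrow> nat) \<Rightarrow> nat \<Rightarrow> (nat \<Rightarrow> (real ^ 'n) set) \<Rightarrow> (real ^ 'n \<Rightarrow> ereal) \<Rightarrow>
    (nat \<Rightarrow> real ^ 'n) \<Rightarrow> bool" where
  "cyclic_bcd b K Xs F x \<longleftrightarrow>
     x 0 \<in> block_product b K Xs \<and> F (x 0) < \<infinity> \<and>
     (\<forall>s. \<forall>k\<in>{1..K}. bcd_step b K Xs F k (x (s * K + k - 1)) (x (s * K + k)))"

definition approx_prox_splitting ::
  "'a::real_normed_vector set \<Rightarrow> ('a \<Rightarrow> ereal) \<Rightarrow> ('a \<Rightarrow> 'a) \<Rightarrow> real \<Rightarrow> (nat \<Rightarrow> 'a) \<Rightarrow> bool" where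
  "approx_prox_splitting X f\<^sub>1 g \<kappa> y \<longleftrightarrow>
     (\<exists>(\<alpha> :: nat \<Rightarrow> real) (e :: nat \<Rightarrow> 'a).
        (\<forall>s. \<alpha> s > 0) \<and> liminf (\<lambda>s. ereal (\<alpha> s)) > 0 \<and>
        (\<forall>s. y (Suc s) =
               prox X (\<lambda>z. ereal (\<alpha> s) * f\<^sub>1 z) (y s - \<alpha> s *\<^sub>R (g (y s) + e s)) \<and>
             norm (e s) \<le> \<kappa> * norm (y s - y (Suc s))))"

end

theory Submission
  imports Defs
begin

text \<open>
  One takes \<open>\<alpha>\<^sup>s = 1\<close>. Let \<open>w\<^sub>k\<close> be the iterate right after the update of block \<open>k\<close> in a cycle from
  \<open>y\<close> to \<open>y'\<close>. Its first order condition says that \<open>y'\<^sub>k\<close> minimises \<open>d\<^sub>k + \<langle>\<nabla>\<^sub>k f\<^sub>2(w\<^sub>k), -\<rangle>\<close> over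
  \<open>X\<^sub>k\<close>. Summed over \<open>k\<close>, this is the optimality condition of the proximal step with
  \<open>e\<^sub>k = \<nabla>\<^sub>k f\<^sub>2(w\<^sub>k) - \<nabla>\<^sub>k f\<^sub>2(y) + y\<^sub>k - y'\<^sub>k\<close>. Each \<open>w\<^sub>k\<close> is a blockwise mixture of \<open>y\<close> and \<open>y'\<close>, so
  \<open>\<parallel>w\<^sub>k - y\<parallel> \<le> \<parallel>y' - y\<parallel>\<close>, and the Lipschitz condition bounds \<open>e\<close>.
\<close>

section \<open>Blocks as coordinate projections\<close>

lemma block_nth [simp]: "block b k x $ i = (if b i = k then x $ i else 0)"
  by (simp add: block_def)

lemma block_upd_nth [simp]: "block_upd b k x z $ i = (if b i = k then z $ i else x $ i)"
  by (simp add: block_upd_def)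

lemma block_spaceD: "z \<in> block_space b k \<Longrightarrow> b i \<noteq> k \<Longrightarrow> z $ i = 0"
  by (simp add: block_space_def)

lemma block_eq_self: "z \<in> block_space b k \<Longrightarrow> block b k z = z"
  by (auto simp: vec_eq_iff block_spaceD)

lemma block_in_block_space [simp]: "block b k x \<in> block_space b k"
  by (simp add: block_space_def)

lemma block_block_upd:
  "z \<in> block_space b k \<Longrightarrow> block b j (block_upd b k x z) = (if j = k then z else block b j x)"
  by (auto simp: vec_eq_iff block_spaceD)

lemma block_upd_block_self [simp]: "block_upd b k x (block b k x) = x"
  by (simp add: vec_eq_iff)

text \<open>As \<open>z - z'\<close> vanishes off block \<open>k\<close>, a segment of block values
  becomes a segment in the full space, along which a smooth function can be differentiated.\<close>

lemma block_upd_segment: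
  assumes "z \<in> block_space b k" "z' \<in> block_space b k"
  shows "block_upd b k x (t *\<^sub>R z + (1 - t) *\<^sub>R z') = block_upd b k x z' + t *\<^sub>R (z - z')"
  using assms by (auto simp: vec_eq_iff block_spaceD algebra_simps)

lemma vec_eqI_blocks:
  assumes "\<And>i. b i \<in> S" "\<And>k. k \<in> S \<Longrightarrow> block b k x = block b k y"
  shows "x = y"
  unfolding vec_eq_iff
proof
  fix i
  show "x $ i = y $ i"
    using arg_cong[OF assms(2)[OF assms(1)[of i]], of "\<lambda>v. v $ i"] by simp
qed

lemma inner_block_left: "block b k u \<bullet> v = block b k u \<bullet> block b k v"
  by (auto simp: inner_vec_def intro!: sum.cong)

lemma inner_block_of_block_space: "v \<in> block_space b k \<Longrightarrow> block b k u \<bullet> v = u \<bullet> v"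
  by (auto simp: inner_vec_def block_spaceD intro!: sum.cong)

lemma norm_block_le: "norm (block b k x) \<le> norm (x :: real ^ 'n::finite)"
  by (rule norm_le_componentwise_cart) simp

text \<open>Isolates the only summand that depends on \<open>z\<close>; the rest acts as a constant
  in a block minimisation.\<close>

lemma separable_sum_block_upd:
  assumes "k \<in> {1..K}" "z \<in> block_space b k"
  shows "separable_sum b K d (block_upd b k x z) = d k z + (\<Sum>j\<in>{1..K} - {k}. d j (block b j x))"
proof -
  have "separable_sum b K d (block_upd b k x z) = (\<Sum>j\<in>{1..K}. if j = k then d k z else d j (block b j x))"
    unfolding separable_sum_def
    by (rule sum.cong) (simp_all add: block_block_upd[OF assms(2)])
  also have "\<dots> = d k z + (\<Sum>j\<in>{1..K} - {k}. if j = k then d k z else d j (block b j x))"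
    using assms(1) by (subst sum.remove[of _ k]) auto
  also have "(\<Sum>j\<in>{1..K} - {k}. if j = k then d k z else d j (block b j x)) =
      (\<Sum>j\<in>{1..K} - {k}. d j (block b j x))"
    by (rule sum.cong) auto
  finally show ?thesis .
qed

section \<open>Minimality and variational inequalities\<close>

text \<open>Convexity bounds \<open>\<phi>\<close> on the segment by its chord, so minimality at
  \<open>t = 0\<close> passes to a differentiable function of \<open>t\<close>, whose right
  derivative there is nonnegative. The points \<open>w\<close> and \<open>z\<^sub>0\<close> are kept
  apart because \<open>f\<close> will see the whole iterate and \<open>\<phi>\<close> only one
  block.\<close>

lemma first_order_condition:
  fixes \<phi> :: "'a::real_inner \<Rightarrow> ereal" and f :: "'a \<Rightarrow> real"
  assumes \<phi>: "ereal_convex_on S \<phi>" and C: "convex C" "C \<subseteq> S" "z\<^sub>0 \<in> C" "z \<in> C"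
    and fin: "\<bar>\<phi> z\<^sub>0\<bar> \<noteq> \<infinity>" and ninf: "\<phi> z \<noteq> -\<infinity>"
    and grad: "GDERIV f w :> D"
    and min: "\<And>t. t \<in> {0..1} \<Longrightarrow>
      \<phi> z\<^sub>0 + ereal (f w) \<le> \<phi> (t *\<^sub>R z + (1 - t) *\<^sub>R z\<^sub>0) + ereal (f (w + t *\<^sub>R (z - z\<^sub>0)))"
  shows "\<phi> z\<^sub>0 \<le> \<phi> z + ereal (D \<bullet> (z - z\<^sub>0))"
proof (cases "\<phi> z = \<infinity>")
  case False
  with ninf obtain q where q: "\<phi> z = ereal q" by (cases "\<phi> z") auto
  from fin obtain p where p: "\<phi> z\<^sub>0 = ereal p" by (cases "\<phi> z\<^sub>0") auto
  \<comment> \<open>The smooth part plus the chord of \<open>\<phi>\<close> from \<open>p\<close> to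
    \<open>q\<close>, with the constant \<open>p\<close> dropped.\<close>
  define \<psi> where "\<psi> t = f (w + t *\<^sub>R (z - z\<^sub>0)) + t * (q - p)" for t
  have nonneg: "\<psi> 0 \<le> \<psi> t" if t: "t \<in> {0..1}" for t
  proof -
    have "\<phi> (t *\<^sub>R z + (1 - t) *\<^sub>R z\<^sub>0) \<le> ereal t * \<phi> z + ereal (1 - t) * \<phi> z\<^sub>0"
      using \<phi> C t unfolding ereal_convex_on_def by blast
    then have "\<phi> z\<^sub>0 + ereal (f w)
        \<le> ereal t * \<phi> z + ereal (1 - t) * \<phi> z\<^sub>0 + ereal (f (w + t *\<^sub>R (z - z\<^sub>0)))"
      using min[OF t] by (meson add_right_mono order_trans)
    then show ?thesis
      by (simp add: p q \<psi>_def algebra_simps)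
  qed
  have "(f has_derivative (\<lambda>h. h \<bullet> D)) (at w)"
    using grad by (simp add: gderiv_def)
  then have "(f has_derivative (\<lambda>h. h \<bullet> D)) (at (w + 0 *\<^sub>R (z - z\<^sub>0)))"
    by simp
  then have "((\<lambda>t. f (w + t *\<^sub>R (z - z\<^sub>0))) has_derivative (\<lambda>t. (t *\<^sub>R (z - z\<^sub>0)) \<bullet> D)) (at 0)"
    by (rule has_derivative_compose[rotated]) (auto intro!: derivative_eq_intros)
  then have "(\<psi> has_derivative (\<lambda>t. (t *\<^sub>R (z - z\<^sub>0)) \<bullet> D + t * (q - p))) (at 0)"
    unfolding \<psi>_def by (auto intro!: derivative_eq_intros)
  then have deriv: "(\<psi> has_real_derivative ((z - z\<^sub>0) \<bullet> D + (q - p))) (at 0)"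
    unfolding has_field_derivative_def
    by (rule has_derivative_eq_rhs) (simp add: fun_eq_iff algebra_simps)
  have "0 \<le> (z - z\<^sub>0) \<bullet> D + (q - p)"
  proof (rule ccontr)
    assume "\<not> ?thesis"
    then obtain \<delta> where \<delta>: "\<delta> > 0" "\<And>h. 0 < h \<Longrightarrow> h < \<delta> \<Longrightarrow> \<psi> (0 + h) < \<psi> 0"
      using DERIV_neg_dec_right[OF deriv] by auto
    \<comment> \<open>The test point must lie both below \<open>\<delta>\<close>, where
      \<open>\<psi>\<close> has decreased, and in the unit interval, where \<open>nonneg\<close>
      holds.\<close>
    show False
      using \<delta>(2)[of "min 1 (\<delta> / 2)"] nonneg[of "min 1 (\<delta> / 2)"] \<delta>(1)
      by (cases "2 \<le> \<delta>") (auto simp: min_def)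
  qed
  then show ?thesis
    by (simp add: p q inner_commute algebra_simps)
qed simp

text \<open>Expanding the square around \<open>y\<close> turns the variational inequality into
  quadratic growth of the prox objective. Growth gives minimality and also the uniqueness that the
  definite description in \<open>prox\<close> requires.\<close>

lemma prox_eqI:
  fixes y c :: "'a::real_inner"
  assumes y: "y \<in> X" and fin: "\<bar>\<phi> y\<bar> \<noteq> \<infinity>"
    and vi: "\<And>z. z \<in> X \<Longrightarrow> \<phi> y \<le> \<phi> z + ereal (c \<bullet> (z - y))"
  shows "prox X \<phi> (y - c) = y"
proof -
  define \<Phi> where "\<Phi> z = \<phi> z + ereal (1/2 * (norm (z - (y - c)))\<^sup>2)" for z
  have growth: "\<Phi> y + ereal (1/2 * (norm (z - y))\<^sup>2) \<le> \<Phi> z" if "z \<in> X" for z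
  proof -
    obtain p where p: "\<phi> y = ereal p" using fin by (cases "\<phi> y") auto
    \<comment> \<open>Half the cross term is the linear term of \<open>vi\<close>; the constant in
      \<open>c\<close> also occurs in \<open>\<Phi> y\<close> and cancels.\<close>
    have "(norm (z - (y - c)))\<^sup>2 = (norm (z - y))\<^sup>2 + 2 * (c \<bullet> (z - y)) + (norm c)\<^sup>2"
      unfolding power2_norm_eq_inner by (simp add: inner_simps inner_commute algebra_simps)
    with vi[OF that] show ?thesis
      by (cases "\<phi> z") (simp_all add: \<Phi>_def p field_simps)
  qed
  have fin': "\<bar>\<Phi> y\<bar> \<noteq> \<infinity>"
    using fin by (cases "\<phi> y") (auto simp: \<Phi>_def)
  have "is_arg_min \<Phi> (\<lambda>z. z \<in> X) y"
    unfolding is_arg_min_linorder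
  proof (intro conjI allI impI)
    fix z assume "z \<in> X"
    have "\<Phi> y \<le> \<Phi> y + ereal (1/2 * (norm (z - y))\<^sup>2)"
      by (cases "\<Phi> y") auto
    then show "\<Phi> y \<le> \<Phi> z"
      using growth[OF \<open>z \<in> X\<close>] by (rule order_trans)
  qed (fact y)
  moreover have "z = y" if "is_arg_min \<Phi> (\<lambda>z. z \<in> X) z" for z
  proof -
    have "\<Phi> y + ereal (1/2 * (norm (z - y))\<^sup>2) \<le> \<Phi> y"
      using that growth[of z] y unfolding is_arg_min_linorder by (meson order_trans)
    with fin' have "(norm (z - y))\<^sup>2 \<le> 0"
      by (cases "\<Phi> y") auto
    then show ?thesis by simp
  qed
  ultimately show ?thesis
    unfolding prox_def \<Phi>_def[symmetric] by (rule the_equality)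
qed

section \<open>Optimality of a single block update\<close>

lemma separable_sum_finite_iff:
  assumes "\<And>k. k \<in> {1..K} \<Longrightarrow> d k (block b k x) \<noteq> -\<infinity>"
  shows "separable_sum b K d x < \<infinity> \<longleftrightarrow> (\<forall>k\<in>{1..K}. \<bar>d k (block b k x)\<bar> \<noteq> \<infinity>)"
proof -
  have "separable_sum b K d x = \<infinity> \<longleftrightarrow> (\<exists>k\<in>{1..K}. d k (block b k x) = \<infinity>)"
    unfolding separable_sum_def by (subst sum_Pinfty) auto
  with assms show ?thesis
    by (auto simp: less_top[symmetric] top_ereal_def)
qed

text \<open>The last conclusion is the optimality of block \<open>k\<close> for the problem linearised at the new
  iterate \<open>x'\<close>.\<close>

lemma bcd_step_optimality:
  fixes b :: "'n::finite \<Rightarrow> nat" and d :: "nat \<Rightarrow> real ^ 'n \<Rightarrow> ereal"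
  assumes blocks: "\<And>i. b i \<in> {1..K}"
    and Xs: "\<And>k. k \<in> {1..K} \<Longrightarrow> Xs k \<subseteq> block_space b k \<and> convex (Xs k)"
    and d_proper: "\<And>k. k \<in> {1..K} \<Longrightarrow> proper_fun_on (block_space b k) (d k)"
    and d_convex: "\<And>k. k \<in> {1..K} \<Longrightarrow> ereal_convex_on (block_space b k) (d k)"
    and grad: "\<And>x. GDERIV f x :> g x"
    and k: "k \<in> {1..K}"
    and step: "bcd_step b K Xs (\<lambda>x. separable_sum b K d x + ereal (f x)) k x x'"
    and x: "x \<in> block_product b K Xs" "separable_sum b K d x < \<infinity>"
  shows "x' \<in> block_product b K Xs" "separable_sum b K d x' < \<infinity>"
    "\<And>z. z \<in> Xs k \<Longrightarrow>
       d k (block b k x') \<le> d k z + ereal (block b k (g x') \<bullet> (z - block b k x'))"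
proof -
  let ?F = "\<lambda>x. separable_sum b K d x + ereal (f x)"
  let ?z = "block b k x'"
  have others: "block b j x' = block b j x" if "j \<in> {1..K}" "j \<noteq> k" for j
    using step that by (simp add: bcd_step_def)
  have z: "?z \<in> Xs k" and
    min: "\<And>z. z \<in> Xs k \<Longrightarrow> ?F (block_upd b k x ?z) \<le> ?F (block_upd b k x z)"
    using step by (auto simp: bcd_step_def is_arg_min_linorder)
  have x'_eq: "block_upd b k x ?z = x'"
  proof (rule vec_eqI_blocks[OF blocks])
    fix j assume "j \<in> {1..K}"
    then show "block b j (block_upd b k x ?z) = block b j x'"
      by (simp add: block_block_upd others)
  qed
  show "x' \<in> block_product b K Xs"
    unfolding block_product_def
  proof (intro CollectI ballI)
    fix j assume "j \<in> {1..K}"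
    then show "block b j x' \<in> Xs j"
      using x(1) z others by (cases "j = k") (auto simp: block_product_def)
  qed
  \<comment> \<open>The old block is itself a candidate, so the step cannot increase the objective
    and finiteness is inherited.\<close>
  have "?F x' \<le> ?F x"
    using min[of "block b k x"] x(1) k by (simp add: x'_eq block_product_def)
  then show fin': "separable_sum b K d x' < \<infinity>"
    using x(2) by (cases "separable_sum b K d x"; cases "separable_sum b K d x'") auto
  have ninf: "d j v \<noteq> -\<infinity>" if "j \<in> {1..K}" "v \<in> block_space b j" for j v
    using d_proper that by (auto simp: proper_fun_on_def)
  have fin: "\<bar>d j (block b j x)\<bar> \<noteq> \<infinity>" if "j \<in> {1..K}" for j
    using x(2) that separable_sum_finite_iff[of K d b x] ninf by auto
  \<comment> \<open>The contribution of the untouched blocks; being finite, it can be cancelled in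
    extended-real inequalities.\<close>
  define R where "R = (\<Sum>j\<in>{1..K} - {k}. d j (block b j x))"
  have R: "\<bar>R\<bar> \<noteq> \<infinity>"
    unfolding R_def using fin by (subst sum_Inf) auto
  fix z assume zX: "z \<in> Xs k"
  have sp: "z \<in> block_space b k" "?z \<in> block_space b k"
    using Xs[OF k] zX by auto
  have "d k ?z \<le> d k z + ereal (g x' \<bullet> (z - ?z))"
  proof (rule first_order_condition[OF d_convex[OF k] _ _ z zX _ _ grad])
    show "\<bar>d k ?z\<bar> \<noteq> \<infinity>"
      using fin' k separable_sum_finite_iff[of K d b x'] ninf by auto
    show "d k z \<noteq> -\<infinity>"
      using ninf k sp by blast
    fix t :: real assume t: "t \<in> {0..1}"
    let ?v = "t *\<^sub>R z + (1 - t) *\<^sub>R ?z"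
    have v: "?v \<in> Xs k"
      using Xs[OF k] z zX t by (auto intro!: convexD)
    then have v': "?v \<in> block_space b k"
      using Xs[OF k] by blast
    \<comment> \<open>Block minimality tested at a point of the segment from \<open>?z\<close> to
      \<open>z\<close>, which stays in \<open>Xs k\<close> by convexity.\<close>
    have "d k ?z + R + ereal (f x') \<le> d k ?v + R + ereal (f (x' + t *\<^sub>R (z - ?z)))"
      using min[OF v] separable_sum_block_upd[OF k sp(2), of d x]
        separable_sum_block_upd[OF k v', of d x] block_upd_segment[OF sp, of x t]
      by (simp add: x'_eq R_def)
    then show "d k ?z + ereal (f x') \<le> d k ?v + ereal (f (x' + t *\<^sub>R (z - ?z)))"
      using R by (cases R; cases "d k ?z"; cases "d k ?v") auto
  qed (use Xs[OF k] in auto)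
  moreover have "z - ?z \<in> block_space b k"
    using sp by (simp add: block_space_def)
  ultimately show "d k ?z \<le> d k z + ereal (block b k (g x') \<bullet> (z - ?z))"
    by (simp add: inner_block_of_block_space)
qed

section \<open>Intermediate iterates of one cycle\<close>

text \<open>Within a cycle, block \<open>j\<close> changes only at step \<open>j\<close>.\<close>

lemma bcd_cycle_blocks:
  assumes steps: "\<And>k. k \<in> {1..K} \<Longrightarrow> bcd_step b K Xs F k (u (k - 1)) (u k)"
    and "m \<le> K" "j \<in> {1..K}"
  shows "block b j (u m) = (if j \<le> m then block b j (u j) else block b j (u 0))"
  using \<open>m \<le> K\<close>
proof (induction m)
  case 0
  then show ?case using assms(3) by auto
next
  case (Suc m)
  have "block b j (u (Suc m)) = block b j (u m)" if "j \<noteq> Suc m"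
    using steps[of "Suc m"] Suc.prems assms(3) that by (simp add: bcd_step_def)
  then show ?case
    using Suc by (cases "j = Suc m") auto
qed

text \<open>Each coordinate of \<open>u m - u 0\<close> is either zero or already equal to that of
  \<open>u K - u 0\<close>.\<close>

lemma bcd_cycle_norm_le:
  fixes b :: "'n::finite \<Rightarrow> nat"
  assumes blocks: "\<And>i. b i \<in> {1..K}"
    and steps: "\<And>k. k \<in> {1..K} \<Longrightarrow> bcd_step b K Xs F k (u (k - 1)) (u k)"
    and "m \<le> K"
  shows "norm (u m - u 0) \<le> norm (u K - u 0)"
proof (rule norm_le_componentwise_cart)
  fix i
  have nth: "u m' $ i = (if b i \<le> m' then u (b i) $ i else u 0 $ i)" if "m' \<le> K" for m'
    using arg_cong[OF bcd_cycle_blocks[of K b Xs F u, OF steps that blocks[of i]], of "\<lambda>v. v $ i"]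
    by (simp split: if_splits)
  show "norm ((u m - u 0) $ i) \<le> norm ((u K - u 0) $ i)"
    using nth[OF \<open>m \<le> K\<close>] nth[of K] blocks[of i] by auto
qed

section \<open>Cyclic descent as approximate proximal splitting\<close>

theorem propositionV1:
  fixes b :: "'n::finite \<Rightarrow> nat" and K :: nat
    and Xs :: "nat \<Rightarrow> (real ^ 'n) set"
    and d :: "nat \<Rightarrow> real ^ 'n \<Rightarrow> ereal"
    and f\<^sub>1 F :: "real ^ 'n \<Rightarrow> ereal"
    and f\<^sub>2 :: "real ^ 'n \<Rightarrow> real" and g :: "real ^ 'n \<Rightarrow> real ^ 'n"
    and X :: "(real ^ 'n) set" and L \<gamma> :: real
  assumes blocks: "\<And>i. b i \<in> {1..K}"
    and Xs: "\<And>k. k \<in> {1..K} \<Longrightarrow> Xs k \<subseteq> block_space b k \<and> closed (Xs k) \<and> convex (Xs k)"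
    and X_def: "X = block_product b K Xs"
    and X_nonempty: "X \<noteq> {}"
    and d_proper: "\<And>k. k \<in> {1..K} \<Longrightarrow> proper_fun_on (block_space b k) (d k)"
    and d_convex: "\<And>k. k \<in> {1..K} \<Longrightarrow> ereal_convex_on (block_space b k) (d k)"
    and d_closed: "\<And>k. k \<in> {1..K} \<Longrightarrow> closed_fun_on (block_space b k) (d k)"
    and d_finite: "\<And>k. k \<in> {1..K} \<Longrightarrow> \<exists>z\<in>Xs k. d k z < \<infinity>"
    and f1_def: "f\<^sub>1 = separable_sum b K d"
    and f2_convex: "convex_on UNIV f\<^sub>2"
    and f2_grad: "\<And>x. GDERIV f\<^sub>2 x :> g x"
    and f2_lipschitz: "L-lipschitz_on UNIV g"
    and gamma_pos: "\<gamma> > 0"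
    and f2_strong: "block_strongly_convex b K Xs f\<^sub>2 g \<gamma>"
    and F_def: "F = (\<lambda>x. f\<^sub>1 x + ereal (f\<^sub>2 x))"
  shows "\<exists>\<kappa>>0. \<forall>x. cyclic_bcd b K Xs F x \<longrightarrow>
           approx_prox_splitting X f\<^sub>1 g \<kappa> (\<lambda>s. x (s * K))"
proof -
  have L: "L \<ge> 0" using f2_lipschitz by (rule lipschitz_on_nonneg)
  have d_ninf: "d k v \<noteq> -\<infinity>" if "k \<in> {1..K}" "v \<in> block_space b k" for k v
    using d_proper that by (auto simp: proper_fun_on_def)
  have Xs': "Xs k \<subseteq> block_space b k \<and> convex (Xs k)" if "k \<in> {1..K}" for k
    using Xs[OF that] by blast
  note step_opt = bcd_step_optimality[OF blocks Xs' d_proper d_convex f2_grad]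
  \<comment> \<open>Each of the \<open>K\<close> gradient differences in the error contributes at
    most \<open>L\<close>; the displacement of the cycle contributes 1, which also keeps the
    constant positive when \<open>L = 0\<close>.\<close>
  have "approx_prox_splitting X f\<^sub>1 g (real K * L + 1) (\<lambda>s. x (s * K))"
    if cyc: "cyclic_bcd b K Xs F x" for x
  proof -
    \<comment> \<open>Index \<open>k\<close> runs from 0 to \<open>K\<close>, so consecutive cycles
      share an endpoint: \<open>u s K = u (Suc s) 0\<close>.\<close>
    define u where "u s k = x (s * K + k)" for s k
    have steps: "bcd_step b K Xs F k (u s (k - 1)) (u s k)" if "k \<in> {1..K}" for s k
      using cyc that by (simp add: cyclic_bcd_def u_def)
    note steps' = steps[unfolded F_def f1_def]
    \<comment> \<open>Feasibility and finiteness must be carried along, since the optimality of step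
      \<open>k\<close> presupposes them for \<open>u s (k - 1)\<close>.\<close>
    have cycle: "u s m \<in> X \<and> f\<^sub>1 (u s m) < \<infinity>"
      if start: "u s 0 \<in> X \<and> f\<^sub>1 (u s 0) < \<infinity>" and "m \<le> K" for s m
      using \<open>m \<le> K\<close>
    proof (induction m)
      case (Suc m)
      then have k: "Suc m \<in> {1..K}" by simp
      show ?case
        using Suc step_opt(1,2)[OF _ _ _ k steps'[OF k, of s]]
        by (simp add: X_def f1_def)
    qed (use start in simp)
    have start: "u s 0 \<in> X \<and> f\<^sub>1 (u s 0) < \<infinity>" for s
    proof (induction s)
      case 0
      have "x 0 \<in> X" "f\<^sub>1 (x 0) + ereal (f\<^sub>2 (x 0)) < \<infinity>"
        using cyc by (auto simp: cyclic_bcd_def X_def F_def)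
      then show ?case by (cases "f\<^sub>1 (x 0)") (auto simp: u_def)
    next
      case (Suc s)
      moreover have "u (Suc s) 0 = u s K" by (simp add: u_def add.commute)
      ultimately show ?case using cycle[of s K] by simp
    qed
    define e where
      "e s = (\<Sum>k=1..K. block b k (g (u s k) - g (u s 0))) + (u s 0 - u s K)" for s
    have sum_block: "(\<Sum>k=1..K. block b k v) = v" for v
      using blocks by (auto simp: vec_eq_iff if_distrib cong: if_cong)
    have e_le: "norm (e s) \<le> (real K * L + 1) * norm (u s 0 - u s K)" for s
    proof -
      have "norm (block b k (g (u s k) - g (u s 0))) \<le> L * norm (u s 0 - u s K)"
        if k: "k \<in> {1..K}" for k
      proof -
        have "norm (block b k (g (u s k) - g (u s 0))) \<le> norm (g (u s k) - g (u s 0))"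
          by (rule norm_block_le)
        also have "\<dots> \<le> L * norm (u s k - u s 0)"
          using lipschitz_onD[OF f2_lipschitz, of "u s k" "u s 0"] by (simp add: dist_norm)
        also have "\<dots> \<le> L * norm (u s K - u s 0)"
          using bcd_cycle_norm_le[of b K Xs F "u s" k, OF blocks steps] k L
          by (intro mult_left_mono) auto
        finally show ?thesis by (simp add: norm_minus_commute)
      qed
      then have "norm (\<Sum>k=1..K. block b k (g (u s k) - g (u s 0))) \<le>
          real (card {1..K}) * (L * norm (u s 0 - u s K))"
        by (intro sum_norm_bound)
      then show ?thesis
        unfolding e_def by (intro norm_triangle_le) (simp add: algebra_simps)
    qed
    have prox: "u s K = prox X f\<^sub>1 (u s 0 - (g (u s 0) + e s))" for s
    proof -
      define c where "c = (\<Sum>k=1..K. block b k (g (u s k)))"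
      have "block b k (v - w) = block b k v - block b k w" for k and v w :: "real ^ 'n"
        by (simp add: vec_eq_iff)
      \<comment> \<open>The error is built so that \<open>g (u s 0)\<close> and \<open>u s 0\<close>
        cancel, leaving the form that \<open>prox_eqI\<close> expects.\<close>
      then have "u s 0 - (g (u s 0) + e s) = u s K - c"
        by (simp add: e_def c_def sum_subtractf sum_block del: One_nat_def)
      moreover have "prox X f\<^sub>1 (u s K - c) = u s K"
      proof (rule prox_eqI)
        show "u s K \<in> X" using cycle[OF start, of K] by simp
        have "f\<^sub>1 (u s K) < \<infinity>" using cycle[OF start, of K] by simp
        then show "\<bar>f\<^sub>1 (u s K)\<bar> \<noteq> \<infinity>"
          using separable_sum_finite_iff[of K d b "u s K"] d_ninf
          unfolding f1_def separable_sum_def by (subst sum_Inf) auto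
        fix z assume z: "z \<in> X"
        have "d k (block b k (u s K)) \<le>
            d k (block b k z) + ereal (block b k (g (u s k)) \<bullet> (z - u s K))"
          if k: "k \<in> {1..K}" for k
        proof -
          \<comment> \<open>Block \<open>k\<close> is final after step \<open>k\<close>, so the
            inequality obtained at \<open>u s k\<close> speaks about the end of the cycle; only the
            gradient remains evaluated at \<open>u s k\<close>.\<close>
          have "block b k (u s K) = block b k (u s k)"
            using bcd_cycle_blocks[of K b Xs F "u s" K k, OF steps] k by simp
          moreover have "d k (block b k (u s k)) \<le> d k (block b k z) +
              ereal (block b k (g (u s k)) \<bullet> (block b k z - block b k (u s k)))"
            using step_opt(3)[OF _ _ _ k steps'[OF k, of s], of "block b k z"]
              cycle[OF start, of "k - 1" s] z k
            by (auto simp: X_def f1_def block_product_def)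
          moreover have "block b k (g (u s k)) \<bullet> (block b k z - block b k (u s K)) =
              block b k (g (u s k)) \<bullet> (z - u s K)"
            by (simp add: inner_diff_right inner_block_left[symmetric])
          ultimately show ?thesis by simp
        qed
        then have "f\<^sub>1 (u s K) \<le> (\<Sum>k=1..K. d k (block b k z) +
            ereal (block b k (g (u s k)) \<bullet> (z - u s K)))"
          unfolding f1_def separable_sum_def by (intro sum_mono)
        then show "f\<^sub>1 (u s K) \<le> f\<^sub>1 z + ereal (c \<bullet> (z - u s K))"
          by (simp add: f1_def separable_sum_def c_def sum.distrib inner_sum_left)
      qed
      ultimately show ?thesis by simp
    qed
    show ?thesis
      unfolding approx_prox_splitting_def
    proof (intro exI conjI allI)
      show "liminf (\<lambda>s. ereal 1) > 0" by (simp add: Liminf_const)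
      fix s
      show "x (Suc s * K) = prox X (\<lambda>z. ereal 1 * f\<^sub>1 z) (x (s * K) - 1 *\<^sub>R (g (x (s * K)) + e s))"
        using prox[of s] by (simp add: u_def add.commute)
      show "norm (e s) \<le> (real K * L + 1) * norm (x (s * K) - x (Suc s * K))"
        using e_le[of s] by (simp add: u_def add.commute)
    qed simp
  qed
  moreover have "real K * L + 1 > 0" using L by (simp add: add_nonneg_pos)
  ultimately show ?thesis by blast
qed

end
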